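(* Let $T$ be a tree of order $n\ge 2$. Then $\gamma_{\rm esp}(T)=\frac{1}{2}n$ if and only if there exists a $2$-coloring of $T$ such that $T\in\mathcal{T}$.
   Context: Graphs are finite, simple and undirected. For a graph $G=(V,E)$ and $S\subseteq V$, write $\overline{S}=V\setminus S$, and let $N(v)$ be the open neighbourhood of $v$. A set $S \subseteq V$ is an end super dominating set (ESD-set) of $G$ if for every $u\in\overline{S}$ there exists $v\in S$ with $N(v)\cap\overline{S}=\{u\}$, and moreover $\deg(u)\ge 2$ for every $u\in\overline{S}$. The end super domination number $\gamma_{\rm esp}(G)$ is the minimum cardinality of an ESD-set of $G$. A $2$-coloring of a tree $T$ is an assignment of one of the two colors amber and blue to each vertex of $T$ (no properness is required). The family $\mathcal{T}$ is the family of $2$-colored trees that can be obtained as the last term $T_k$ of a sequence $T_1,\ldots,T_k$, $k\ge 1$, of $2$-colored trees, where $T_1$ is the path $P_4$ with its two leaves colored blue and its two vertices of degree $2$ colored amber, and, if $k\ge 2$, for each $i\in\{1,\ldots,k-1\}$ the $2$-colored tree $T_{i+1}$ is obtained from $T_i$ by one of the following two operations. Operation $\mathcal{O}_1$: add a (vertex-disjoint) path $P_2$ to $T_i$, with one vertex of the added path colored amber and the other blue, and add an edge from the amber vertex of the added path to an amber vertex of $T_i$. Operation $\mathcal{O}_2$: add a (vertex-disjoint) path $P_4$ to $T_i$, with its two leaves colored blue and its two vertices of degree $2$ colored amber, and add an edge from a (blue) leaf of the added path to a blue vertex of $T_i$. *)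

theory Defs
  imports Complex_Main "Graph_Theory.Digraph_Component"
begin

text \<open>
  A finite simple undirected graph is a \<^locale>\<open>pair_graph\<close>: a finite, loop-free, symmetric
  digraph whose arcs are pairs of vertices, so that an edge is a pair of opposite arcs.
\<close>

text \<open>
  The library constant \<^const>\<open>tree\<close> cannot be used for symmetric digraphs, because its notion of
  cycle includes the closed walk along an edge and back. Excluding only the cycles of length
  at least 3 gives acyclicity of the underlying undirected graph.
\<close>

definition undirected_tree :: "'a pair_pre_digraph \<Rightarrow> bool" where
  "undirected_tree G \<longleftrightarrow>
     pair_graph G \<and> connected (with_proj G) \<and>
     (\<nexists>p. pre_digraph.cycle (with_proj G) p \<and> 3 \<le> length p)"

definition open_nbhd :: "'a pair_pre_digraph \<Rightarrow> 'a \<Rightarrow> 'a set" where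
  "open_nbhd G v = {u. (v, u) \<in> parcs G}"

text \<open>In a symmetric digraph, \<^const>\<open>out_degree\<close> is the degree of the undirected graph.\<close>

definition esd_set :: "'a pair_pre_digraph \<Rightarrow> 'a set \<Rightarrow> bool" where
  "esd_set G S \<longleftrightarrow>
     S \<subseteq> pverts G \<and>
     (\<forall>u \<in> pverts G - S. \<exists>v \<in> S. open_nbhd G v \<inter> (pverts G - S) = {u}) \<and>
     (\<forall>u \<in> pverts G - S. 2 \<le> out_degree (with_proj G) u)"

text \<open>
  For a finite graph the minimum is over a finite set of cardinalities, which is nonempty by
  \<open>esd_set_pverts\<close> below.
\<close>

definition esp_number :: "'a pair_pre_digraph \<Rightarrow> nat" where
  "esp_number G = Min (card ` {S. esd_set G S})"

lemma esd_set_pverts: "esd_set G (pverts G)"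
  by (simp add: esd_set_def)

definition path_graph :: "'a list \<Rightarrow> 'a pair_pre_digraph" where
  "path_graph xs =
     \<lparr> pverts = set xs, parcs = set (zip xs (tl xs)) \<union> (set (zip xs (tl xs)))\<inverse> \<rparr>"

definition join_by_edge ::
  "'a pair_pre_digraph \<Rightarrow> 'a pair_pre_digraph \<Rightarrow> 'a \<Rightarrow> 'a \<Rightarrow> 'a pair_pre_digraph" where
  "join_by_edge G H u v =
     \<lparr> pverts = pverts G \<union> pverts H, parcs = parcs G \<union> parcs H \<union> {(u, v), (v, u)} \<rparr>"

datatype color = Amber | Blue

text \<open>
  A 2-coloring of a graph is a function on the whole vertex type; its values outside the vertex
  set are irrelevant. Vertex names are arbitrary, so the family contains
  all isomorphic copies on the type \<^typ>\<open>'a\<close> of each of its members.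
\<close>

inductive_set colored_family :: "('a pair_pre_digraph \<times> ('a \<Rightarrow> color)) set" where
  base:
    "\<lbrakk> distinct [a, b, c, d]; f a = Blue; f b = Amber; f c = Amber; f d = Blue \<rbrakk>
     \<Longrightarrow> (path_graph [a, b, c, d], f) \<in> colored_family"
| op1:
    "\<lbrakk> (G, f) \<in> colored_family; w \<in> pverts G; f w = Amber;
       distinct [x, y]; {x, y} \<inter> pverts G = {} \<rbrakk>
     \<Longrightarrow> (join_by_edge G (path_graph [x, y]) w x, f(x := Amber, y := Blue)) \<in> colored_family"
| op2:
    "\<lbrakk> (G, f) \<in> colored_family; w \<in> pverts G; f w = Blue;
       distinct [a, b, c, d]; {a, b, c, d} \<inter> pverts G = {} \<rbrakk>
     \<Longrightarrow> (join_by_edge G (path_graph [a, b, c, d]) w a,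
          f(a := Blue, b := Amber, c := Amber, d := Blue)) \<in> colored_family"

end

theory Submission
  imports Defs
begin

text \<open>
  An ESD-set \<open>S\<close> comes with an injection of its complement into \<open>S\<close>, so \<open>2 |S| \<ge> n\<close>. In case of
  equality the injection is a bijection; then colouring \<open>S\<close> blue and its complement amber, every
  vertex has exactly one neighbour of the other colour, and every amber vertex has an amber
  neighbour. Conversely, the blue class of such a colouring is an ESD-set of size \<open>n / 2\<close>.
  Both operations preserve these two conditions. Given a tree with such a colouring, take a maximal
  connected subtree that is closed under passing to the neighbour of the other colour and belongs
  to the family. An edge leaving it joins two vertices of the same colour, and gives an extension
  by one of the two operations: by an amber vertex and its blue neighbour, or by a blue vertex,
  its amber neighbour, an amber neighbour of that one, and the blue neighbour of the latter. As two
  disjoint connected sets of a tree are joined by at most one edge, no further edges appear.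
\<close>

text \<open>The first conjunct makes the two-coloured edges a perfect matching. Since an amber
  vertex has exactly one blue neighbour, the second conjunct is the degree condition on the
  complement of an ESD-set.\<close>

definition matched_coloring :: "'a pair_pre_digraph \<Rightarrow> ('a \<Rightarrow> color) \<Rightarrow> bool" where
  "matched_coloring G f \<longleftrightarrow>
     (\<forall>v \<in> pverts G. \<exists>!u. (v, u) \<in> parcs G \<and> f u \<noteq> f v) \<and>
     (\<forall>v \<in> pverts G. f v = Amber \<longrightarrow> (\<exists>u. (v, u) \<in> parcs G \<and> f u = Amber))"

lemma not_Amber_iff [simp]: "c \<noteq> Amber \<longleftrightarrow> c = Blue"
  by (cases c) auto

lemma not_Blue_iff [simp]: "c \<noteq> Blue \<longleftrightarrow> c = Amber"
  by (cases c) auto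

lemma pair_graphD:
  assumes "pair_graph G"
  shows "sym (parcs G)" "parcs G \<subseteq> pverts G \<times> pverts G" "finite (pverts G)" "finite (parcs G)"
proof -
  interpret pair_graph G by fact
  show "sym (parcs G)" using pair_sym_arcs by (simp add: symmetric_def)
  show "parcs G \<subseteq> pverts G \<times> pverts G" by (auto dest: wellformed')
  show "finite (pverts G)" "finite (parcs G)" by (fact pair_finite_verts pair_finite_arcs)+
qed

subsection \<open>ESD-sets containing half of the vertices\<close>

lemma out_degree_with_proj: "out_degree (with_proj G) u = card (open_nbhd G u)"
proof -
  have "out_arcs (with_proj G) u = Pair u ` open_nbhd G u"
    by (auto simp: open_nbhd_def out_arcs_def)
  then show ?thesis
    by (simp add: out_degree_def card_image inj_on_def)
qed

text \<open>A witness for \<open>u\<close> sees only \<open>u\<close> outside \<open>S\<close>, so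
  it determines \<open>u\<close>; hence any choice of witnesses is injective.\<close>

lemma esd_set_injection:
  assumes "esd_set G S"
  obtains \<phi> where "inj_on \<phi> (pverts G - S)" "\<phi> ` (pverts G - S) \<subseteq> S"
    "\<And>u. u \<in> pverts G - S \<Longrightarrow> open_nbhd G (\<phi> u) \<inter> (pverts G - S) = {u}"
proof -
  from assms obtain \<phi> where
    \<phi>: "\<forall>u \<in> pverts G - S. \<phi> u \<in> S \<and> open_nbhd G (\<phi> u) \<inter> (pverts G - S) = {u}"
    unfolding esd_set_def by metis
  have "inj_on \<phi> (pverts G - S)"
  proof (rule inj_onI)
    fix u v assume "u \<in> pverts G - S" "v \<in> pverts G - S" "\<phi> u = \<phi> v"
    with \<phi> have "{u} = {v}" by metis
    then show "u = v" by simp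
  qed
  with \<phi> that show thesis by blast
qed

lemma card_le_twice_esd_set:
  assumes "esd_set G S" "finite (pverts G)"
  shows "card (pverts G) \<le> 2 * card S"
proof -
  have sub: "S \<subseteq> pverts G" using assms by (simp add: esd_set_def)
  then have "finite S" using assms finite_subset by blast
  moreover obtain \<phi> where "inj_on \<phi> (pverts G - S)" "\<phi> ` (pverts G - S) \<subseteq> S"
    using esd_set_injection[OF assms(1)] by metis
  ultimately have "card (pverts G - S) \<le> card S" by (metis card_inj_on_le)
  with sub \<open>finite S\<close> show ?thesis by (simp add: card_Diff_subset)
qed

lemma matched_coloring_if_half_esd_set:
  assumes G: "pair_graph G" and S: "esd_set G S" and half: "card (pverts G) = 2 * card S"
  shows "matched_coloring G (\<lambda>v. if v \<in> S then Blue else Amber)"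
proof -
  note G = pair_graphD[OF G]
  let ?A = "pverts G - S"
  have sub: "S \<subseteq> pverts G" using S by (simp add: esd_set_def)
  then have fin: "finite S" using G finite_subset by blast
  obtain \<phi> where inj: "inj_on \<phi> ?A" and im: "\<phi> ` ?A \<subseteq> S"
    and \<phi>: "\<And>u. u \<in> ?A \<Longrightarrow> open_nbhd G (\<phi> u) \<inter> ?A = {u}"
    using esd_set_injection[OF S] by metis
  have "card ?A = card S" using sub fin half by (simp add: card_Diff_subset)
  then have surj: "\<phi> ` ?A = S"
    using im fin inj by (metis card_image card_subset_eq)
  \<comment> \<open>By surjectivity every \<open>v\<close> in \<open>S\<close> is the witness of
    some vertex and so has that vertex as its only neighbour outside \<open>S\<close>. The edges
    between the two classes are therefore just those of the bijection.\<close>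
  have adj: "(u, v) \<in> parcs G \<longleftrightarrow> v = \<phi> u" if uv: "u \<in> ?A" "v \<in> S" for u v
  proof
    assume "(u, v) \<in> parcs G"
    then have "(v, u) \<in> parcs G" using G(1) by (meson symD)
    moreover obtain w where w: "w \<in> ?A" "v = \<phi> w" using surj uv(2) by (metis imageE)
    ultimately have "u \<in> open_nbhd G (\<phi> w) \<inter> ?A" using uv by (simp add: open_nbhd_def)
    with \<phi>[OF w(1)] w show "v = \<phi> u" by simp
  next
    assume "v = \<phi> u"
    then have "(v, u) \<in> parcs G" using \<phi>[OF uv(1)] by (auto simp: open_nbhd_def)
    then show "(u, v) \<in> parcs G" using G(1) by (meson symD)
  qed
  have blue: "\<exists>!u. (v, u) \<in> parcs G \<and> u \<notin> S" if v: "v \<in> S" for v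
  proof -
    obtain u where u: "u \<in> ?A" "v = \<phi> u" using surj v by (metis imageE)
    have "(v, w) \<in> parcs G \<and> w \<notin> S \<longleftrightarrow> w = u" for w
      using \<phi>[OF u(1)] u G(2) by (auto simp: open_nbhd_def set_eq_iff)
    then show ?thesis by simp
  qed
  have amber: "\<exists>!u. (v, u) \<in> parcs G \<and> u \<in> S" if v: "v \<in> ?A" for v
  proof (rule ex1I)
    show "(v, \<phi> v) \<in> parcs G \<and> \<phi> v \<in> S" using adj[OF v] im v by blast
  qed (use adj[OF v] in blast)
  \<comment> \<open>If all neighbours of \<open>v\<close> were in \<open>S\<close>, then
    \<open>\<phi> v\<close> would be the only one, against degree at least 2.\<close>
  have amber': "\<exists>u. (v, u) \<in> parcs G \<and> u \<notin> S" if v: "v \<in> ?A" for v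
  proof (rule ccontr)
    assume "\<not> ?thesis"
    then have "open_nbhd G v \<subseteq> {\<phi> v}" using adj[OF v] by (auto simp: open_nbhd_def)
    then have "card (open_nbhd G v) \<le> 1" by (metis card_mono finite.intros is_singletonI is_singleton_altdef)
    moreover have "2 \<le> card (open_nbhd G v)"
      using S v by (simp add: esd_set_def out_degree_with_proj)
    ultimately show False by simp
  qed
  show ?thesis
    unfolding matched_coloring_def
  proof (intro conjI ballI impI)
    fix v assume "v \<in> pverts G"
    then show "\<exists>!u. (v, u) \<in> parcs G \<and>
        (if u \<in> S then Blue else Amber) \<noteq> (if v \<in> S then Blue else Amber)"
      using blue[of v] amber[of v] by (cases "v \<in> S") auto
  next
    fix v assume "v \<in> pverts G" "(if v \<in> S then Blue else Amber) = Amber"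
    then show "\<exists>u. (v, u) \<in> parcs G \<and> (if u \<in> S then Blue else Amber) = Amber"
      using amber'[of v] by (auto split: if_splits)
  qed
qed

text \<open>The map \<open>m\<close> to the unique neighbour of the other colour is an involution
  exchanging the colour classes, so they have equal size. For an amber \<open>u\<close> the witness
  is \<open>m u\<close>, and \<open>m u\<close> together with an amber neighbour gives degree at
  least 2.\<close>

lemma half_esd_set_if_matched_coloring:
  assumes G: "pair_graph G" and f: "matched_coloring G f"
  defines "B \<equiv> {v \<in> pverts G. f v = Blue}"
  shows "esd_set G B" "card (pverts G) = 2 * card B"
proof -
  note G = pair_graphD[OF G]
  define m where "m v = (THE u. (v, u) \<in> parcs G \<and> f u \<noteq> f v)" for v
  have m: "(v, m v) \<in> parcs G \<and> f (m v) \<noteq> f v" if "v \<in> pverts G" for v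
  proof -
    have "\<exists>!u. (v, u) \<in> parcs G \<and> f u \<noteq> f v" using f that by (simp add: matched_coloring_def)
    then show ?thesis unfolding m_def by (rule theI')
  qed
  have m_eq: "u = m v" if "(v, u) \<in> parcs G" "f u \<noteq> f v" for u v
  proof -
    have v: "v \<in> pverts G" using that(1) G(2) by blast
    with f have "\<exists>!u. (v, u) \<in> parcs G \<and> f u \<noteq> f v" by (simp add: matched_coloring_def)
    with m[OF v] that show ?thesis by metis
  qed
  have mV: "m v \<in> pverts G" if "v \<in> pverts G" for v using m[OF that] G(2) by blast
  have mm: "m (m v) = v" if "v \<in> pverts G" for v
    using m[OF that] m_eq[of "m v" v] G(1) by (metis symD)
  have diff: "pverts G - B = {v \<in> pverts G. f v = Amber}"
    by (auto simp: B_def)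
  have "bij_betw m B (pverts G - B)"
  proof (rule bij_betwI)
    show "m \<in> B \<rightarrow> pverts G - B" using m mV by (fastforce simp: B_def)
    show "m \<in> pverts G - B \<rightarrow> B" using m mV by (fastforce simp: B_def)
  qed (use mm in \<open>auto simp: B_def\<close>)
  then have "card B = card (pverts G - B)" by (rule bij_betw_same_card)
  moreover have "B \<subseteq> pverts G" "finite B" using G(3) by (auto simp: B_def)
  ultimately show "card (pverts G) = 2 * card B"
    using G(3) card_mono[of "pverts G" B] by (simp add: card_Diff_subset)
  show "esd_set G B"
    unfolding esd_set_def out_degree_with_proj
  proof (intro conjI ballI)
    show "B \<subseteq> pverts G" by fact
  next
    fix u assume u: "u \<in> pverts G - B"
    then have "m u \<in> B" using m[of u] mV by (fastforce simp: B_def)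
    moreover have "open_nbhd G (m u) \<inter> (pverts G - B) = {u}"
    proof -
      have "w = u" if "(m u, w) \<in> parcs G" "f w = Amber" for w
        using m_eq[OF that(1)] that \<open>m u \<in> B\<close> mm[of u] u by (auto simp: B_def)
      moreover have "(m u, u) \<in> parcs G" using m[of u] u G(1) by (auto dest: symD)
      ultimately show ?thesis using u unfolding diff by (auto simp: open_nbhd_def)
    qed
    ultimately show "\<exists>v\<in>B. open_nbhd G v \<inter> (pverts G - B) = {u}" by blast
  next
    fix u assume u: "u \<in> pverts G - B"
    then have "f u = Amber" unfolding diff by simp
    with f u obtain w where w: "(u, w) \<in> parcs G" "f w = Amber"
      unfolding matched_coloring_def by blast
    have "{w, m u} \<subseteq> open_nbhd G u" using w m[of u] u by (simp add: open_nbhd_def)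
    moreover have "w \<noteq> m u" using w m[of u] u \<open>f u = Amber\<close> by auto
    moreover have "finite (open_nbhd G u)"
      using G by (auto simp: open_nbhd_def intro: finite_subset[of _ "pverts G"])
    ultimately show "2 \<le> card (open_nbhd G u)"
      by (metis card_2_iff card_mono)
  qed
qed

text \<open>By \<open>card_le_twice_esd_set\<close> no ESD-set has fewer than half of the vertices,
  so an ESD-set with exactly half of them attains the minimum.\<close>

lemma esp_number_eq_half_iff:
  assumes G: "pair_graph G"
  shows "2 * esp_number G = card (pverts G) \<longleftrightarrow> (\<exists>f. matched_coloring G f)"
proof -
  let ?C = "card ` {S. esd_set G S}"
  have "{S. esd_set G S} \<subseteq> Pow (pverts G)" by (auto simp: esd_set_def)
  then have fin: "finite ?C" using pair_graphD(3)[OF G] finite_subset by blast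
  have ne: "?C \<noteq> {}" using esd_set_pverts by blast
  show ?thesis
  proof
    assume half: "2 * esp_number G = card (pverts G)"
    have "esp_number G \<in> ?C" unfolding esp_number_def using fin ne by (rule Min_in)
    then obtain S where "esd_set G S" "card (pverts G) = 2 * card S" using half by auto
    then show "\<exists>f. matched_coloring G f" using matched_coloring_if_half_esd_set[OF G] by blast
  next
    assume "\<exists>f. matched_coloring G f"
    then obtain B where B: "esd_set G B" "card (pverts G) = 2 * card B"
      using half_esd_set_if_matched_coloring[OF G] by blast
    have "esp_number G = card B"
      unfolding esp_number_def
    proof (rule Min_eqI[OF fin])
      fix k assume "k \<in> ?C"
      then obtain S where "esd_set G S" "k = card S" by blast
      then show "card B \<le> k"
        using card_le_twice_esd_set[of G S] pair_graphD(3)[OF G] B(2) by simp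
    qed (use B in blast)
    then show "2 * esp_number G = card (pverts G)" using B by simp
  qed
qed

subsection \<open>Members of the family are matched\<close>

lemma path_graph_2: "path_graph [x, y] = \<lparr>pverts = {x, y}, parcs = {(x, y), (y, x)}\<rparr>"
  by (auto simp: path_graph_def)

lemma path_graph_4:
  "path_graph [a, b, c, d] =
     \<lparr>pverts = {a, b, c, d}, parcs = {(a, b), (b, a), (b, c), (c, b), (c, d), (d, c)}\<rparr>"
  by (auto simp: path_graph_def)

lemma join_by_edge_wf:
  assumes "parcs G \<subseteq> pverts G \<times> pverts G" "parcs H \<subseteq> pverts H \<times> pverts H"
    and "w \<in> pverts G" "x \<in> pverts H"
  shows "parcs (join_by_edge G H w x) \<subseteq> pverts (join_by_edge G H w x) \<times> pverts (join_by_edge G H w x)"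
  using assms by (auto simp: join_by_edge_def)

lemma colored_family_wf:
  "(G, f) \<in> colored_family \<Longrightarrow> parcs G \<subseteq> pverts G \<times> pverts G"
proof (induction rule: colored_family.induct[split_format(complete)])
  case (base a b c d f)
  show ?case by (auto simp: path_graph_4)
next
  case (op1 G f w x y)
  from op1.IH \<open>w \<in> pverts G\<close> show ?case
    by (intro join_by_edge_wf) (simp_all add: path_graph_2)
next
  case (op2 G f w a b c d)
  from op2.IH \<open>w \<in> pverts G\<close> show ?case
    by (intro join_by_edge_wf) (simp_all add: path_graph_4)
qed

text \<open>The new edge joins vertices of equal colour, so it leaves the neighbours of the other
  colour unchanged, and adding an edge destroys no amber neighbour.\<close>

lemma matched_coloring_join:
  assumes G: "matched_coloring G f" "parcs G \<subseteq> pverts G \<times> pverts G"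
    and H: "matched_coloring H g" "parcs H \<subseteq> pverts H \<times> pverts H"
    and disj: "pverts G \<inter> pverts H = {}"
    and w: "w \<in> pverts G" and x: "x \<in> pverts H"
    and hG: "\<And>v. v \<in> pverts G \<Longrightarrow> h v = f v" and hH: "\<And>v. v \<in> pverts H \<Longrightarrow> h v = g v"
    and same: "f w = g x"
  shows "matched_coloring (join_by_edge G H w x) h"
proof -
  let ?J = "join_by_edge G H w x"
  have J: "(v, u) \<in> parcs ?J \<and> h u \<noteq> h v \<longleftrightarrow>
      (v, u) \<in> parcs G \<and> f u \<noteq> f v \<or> (v, u) \<in> parcs H \<and> g u \<noteq> g v" for u v
    using G(2) H(2) hG hH w x same by (auto simp: join_by_edge_def)
  have 1: "\<exists>!u. (v, u) \<in> parcs ?J \<and> h u \<noteq> h v" if "v \<in> pverts ?J" for v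
  proof (cases "v \<in> pverts G")
    case True
    then have "(v, u) \<notin> parcs H" for u using disj H(2) by blast
    then show ?thesis unfolding J using G(1) True by (simp add: matched_coloring_def)
  next
    case False
    then have "(v, u) \<notin> parcs G" for u using G(2) by blast
    moreover have "v \<in> pverts H" using False that by (simp add: join_by_edge_def)
    ultimately show ?thesis unfolding J using H(1) by (simp add: matched_coloring_def)
  qed
  have 2: "\<exists>u. (v, u) \<in> parcs ?J \<and> h u = Amber" if v: "v \<in> pverts ?J" "h v = Amber" for v
  proof (cases "v \<in> pverts G")
    case True
    then obtain u where "(v, u) \<in> parcs G" "f u = Amber"
      using G(1) v hG by (fastforce simp: matched_coloring_def)
    moreover from this have "h u = Amber" using hG G(2) by auto
    ultimately show ?thesis by (auto simp: join_by_edge_def)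
  next
    case False
    then have vH: "v \<in> pverts H" using v by (simp add: join_by_edge_def)
    then obtain u where "(v, u) \<in> parcs H" "g u = Amber"
      using H(1) v hH by (fastforce simp: matched_coloring_def)
    moreover from this have "h u = Amber" using hH H(2) by auto
    ultimately show ?thesis by (auto simp: join_by_edge_def)
  qed
  from 1 2 show ?thesis by (simp add: matched_coloring_def)
qed

lemma matched_coloring_path_4:
  assumes "distinct [a, b, c, d]" "f a = Blue" "f b = Amber" "f c = Amber" "f d = Blue"
  shows "matched_coloring (path_graph [a, b, c, d]) f"
proof -
  let ?P = "path_graph [a, b, c, d]"
  \<comment> \<open>The middle edge is amber at both ends, so only the two end edges join different
    colours.\<close>
  have nb: "(v, u) \<in> parcs ?P \<and> f u \<noteq> f v \<longleftrightarrow> (v, u) \<in> {(a, b), (b, a), (c, d), (d, c)}" for v u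
    using assms by (auto simp: path_graph_4)
  have "\<exists>!u. (v, u) \<in> {(a, b), (b, a), (c, d), (d, c)}" if "v \<in> {a, b, c, d}" for v
    using assms(1) that by auto
  moreover have "\<exists>u. (v, u) \<in> parcs ?P \<and> f u = Amber" if "v \<in> pverts ?P" "f v = Amber" for v
  proof -
    have "v = b \<or> v = c" using that assms by (auto simp: path_graph_4)
    moreover have "(b, c) \<in> parcs ?P" "(c, b) \<in> parcs ?P" by (simp_all add: path_graph_4)
    ultimately show ?thesis using assms by blast
  qed
  ultimately show ?thesis unfolding matched_coloring_def nb by (simp add: path_graph_4)
qed

text \<open>
  The path added by the first operation is not matched by itself: its amber vertex gets an amber
  neighbour only through the new edge.
\<close>

lemma matched_coloring_op1:
  assumes G: "matched_coloring G f" "parcs G \<subseteq> pverts G \<times> pverts G"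
    and w: "w \<in> pverts G" "f w = Amber"
    and xy: "distinct [x, y]" "{x, y} \<inter> pverts G = {}"
  shows "matched_coloring (join_by_edge G (path_graph [x, y]) w x) (f(x := Amber, y := Blue))"
proof -
  let ?J = "join_by_edge G (path_graph [x, y]) w x" and ?h = "f(x := Amber, y := Blue)"
  have parcs: "parcs ?J = parcs G \<union> {(x, y), (y, x), (w, x), (x, w)}"
    by (auto simp: join_by_edge_def path_graph_2)
  have nbG: "(v, u) \<in> parcs ?J \<and> ?h u \<noteq> ?h v \<longleftrightarrow> (v, u) \<in> parcs G \<and> f u \<noteq> f v"
    if "v \<in> pverts G" for u v
    using G(2) w xy that by (auto simp: parcs)
  have nbx: "(x, u) \<in> parcs ?J \<and> ?h u \<noteq> ?h x \<longleftrightarrow> u = y" for u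
    using G(2) w xy by (auto simp: parcs)
  have nby: "(y, u) \<in> parcs ?J \<and> ?h u \<noteq> ?h y \<longleftrightarrow> u = x" for u
    using G(2) w xy by (auto simp: parcs)
  have "\<exists>!u. (v, u) \<in> parcs ?J \<and> ?h u \<noteq> ?h v" if v: "v \<in> pverts ?J" for v
  proof -
    consider "v \<in> pverts G" | "v = x" | "v = y"
      using v by (auto simp: join_by_edge_def path_graph_2)
    then show ?thesis
    proof cases
      case 1
      then show ?thesis unfolding nbG[OF 1] using G(1) by (simp add: matched_coloring_def)
    next
      case 2
      then show ?thesis unfolding 2 nbx by simp
    next
      case 3
      then show ?thesis unfolding 3 nby by simp
    qed
  qed
  moreover have "\<exists>u. (v, u) \<in> parcs ?J \<and> ?h u = Amber" if v: "v \<in> pverts ?J" "?h v = Amber" for v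
  proof (cases "v \<in> pverts G")
    case True
    then have "f v = Amber" using v(2) xy by (auto split: if_splits)
    then obtain u where "(v, u) \<in> parcs G" "f u = Amber"
      using G(1) True unfolding matched_coloring_def by blast
    then have "(v, u) \<in> parcs ?J" "?h u = Amber" using G(2) xy by (auto simp: parcs)
    then show ?thesis by blast
  next
    case False
    then have "v = x" using v xy by (auto simp: join_by_edge_def path_graph_2)
    then have "(v, w) \<in> parcs ?J" "?h w = Amber" using w xy by (auto simp: parcs)
    then show ?thesis by blast
  qed
  ultimately show ?thesis by (simp add: matched_coloring_def)
qed

lemma matched_coloring_colored_family:
  "(G, f) \<in> colored_family \<Longrightarrow> matched_coloring G f"
proof (induction rule: colored_family.induct[split_format(complete)])
  case (base a b c d f)
  then show ?case by (intro matched_coloring_path_4)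
next
  case (op1 G f w x y)
  then show ?case by (intro matched_coloring_op1 colored_family_wf)
next
  case (op2 G f w a b c d)
  let ?h = "f(a := Blue, b := Amber, c := Amber, d := Blue)"
  \<comment> \<open>The added path is matched by itself, and \<open>?h\<close> agrees with
    \<open>f\<close> on \<open>G\<close> because the new vertices are fresh, so the joining lemma
    applies.\<close>
  have "matched_coloring (path_graph [a, b, c, d]) ?h"
    using op2 by (intro matched_coloring_path_4) auto
  moreover have "parcs G \<subseteq> pverts G \<times> pverts G" using op2 by (intro colored_family_wf)
  ultimately show ?case
    using op2 by (intro matched_coloring_join[of G f _ ?h]) (auto simp: path_graph_4)
qed

subsection \<open>Connected vertex sets of trees\<close>

text \<open>Restricting the relation before taking the closure keeps the connecting walks inside
  \<open>W\<close>; disjoint sets then give vertex-disjoint walks.\<close>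

definition connected_on :: "'a rel \<Rightarrow> 'a set \<Rightarrow> bool" where
  "connected_on R W \<longleftrightarrow> (\<forall>u \<in> W. \<forall>v \<in> W. (u, v) \<in> (Restr R W)\<^sup>*)"

lemma connected_on_singleton: "connected_on R {x}"
  by (simp add: connected_on_def)

lemma connected_on_Un:
  assumes "connected_on R W" "connected_on R X" "w \<in> W" "x \<in> X" "(w, x) \<in> R" "sym R"
  shows "connected_on R (W \<union> X)"
proof -
  let ?R = "(Restr R (W \<union> X))\<^sup>*"
  have mono: "(Restr R W)\<^sup>* \<subseteq> ?R" "(Restr R X)\<^sup>* \<subseteq> ?R"
    by (intro rtrancl_mono; blast)+
  have W: "(u, v) \<in> ?R" if "u \<in> W" "v \<in> W" for u v
    using assms(1) that mono by (auto simp: connected_on_def)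
  have X: "(u, v) \<in> ?R" if "u \<in> X" "v \<in> X" for u v
    using assms(2) that mono by (auto simp: connected_on_def)
  have "(x, w) \<in> R" using assms by (meson symD)
  then have wx: "(w, x) \<in> ?R" "(x, w) \<in> ?R" using assms by auto
  have "(u, v) \<in> ?R" if "u \<in> W \<union> X" "v \<in> W \<union> X" for u v
  proof -
    have "(u, w) \<in> ?R" using that(1) W X wx assms(3,4) by (metis Un_iff rtrancl_trans)
    moreover have "(w, v) \<in> ?R" using that(2) W X wx assms(3,4) by (metis Un_iff rtrancl_trans)
    ultimately show ?thesis by (rule rtrancl_trans)
  qed
  then show ?thesis by (simp add: connected_on_def)
qed

lemma connected_on_edge: "(x, y) \<in> R \<Longrightarrow> sym R \<Longrightarrow> connected_on R {x, y}"
  using connected_on_Un[OF connected_on_singleton connected_on_singleton, of x x y y R]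
  unfolding insert_is_Un[of x "{y}"] by simp

lemma rtrancl_leaves_set:
  assumes "(u, v) \<in> R\<^sup>*" "u \<in> W" "v \<notin> W"
  obtains w x where "(w, x) \<in> R" "w \<in> W" "x \<notin> W"
  using assms(1,3)
proof (induction rule: rtrancl_induct)
  case base
  with assms(2) show ?case by simp
next
  case (step y z)
  then show ?case using that by (cases "y \<in> W") simp_all
qed

lemma undirected_tree_connected:
  assumes T: "undirected_tree T" and uv: "u \<in> pverts T" "v \<in> pverts T"
  shows "(u, v) \<in> (parcs T)\<^sup>*"
proof -
  interpret pair_graph T using T by (simp add: undirected_tree_def)
  \<comment> \<open>\<open>connected\<close> means strong connectivity of the symmetric closure,
    which adds no arcs to a symmetric graph.\<close>
  have "parcs (mk_symmetric (with_proj T)) = parcs T"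
    using adj_mk_symmetric_eq pair_sym_arcs by simp
  moreover have "u \<rightarrow>\<^sup>*\<^bsub>with_proj (mk_symmetric (with_proj T))\<^esub> v"
    using T uv unfolding undirected_tree_def connected_def strongly_connected_def by simp
  ultimately have "(u, v) \<in> rtrancl_on (pverts T) (parcs T)"
    by (simp add: reachable_def)
  then show ?thesis by (rule rtrancl_on_rtranclI)
qed

text \<open>Reachability inside \<open>W\<close> gives a walk with all arcs in
  \<open>W \<times> W\<close>. Shortening it to a path only discards arcs, so the path stays in
  \<open>W\<close>.\<close>

lemma (in pair_wf_digraph) apath_within:
  assumes "(u, v) \<in> (Restr (parcs G) W)\<^sup>*" "u \<in> W" "W \<subseteq> pverts G"
  obtains p where "awalk u p v" "distinct (pawalk_verts u p)" "set (pawalk_verts u p) \<subseteq> W"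
proof -
  have "\<exists>p. awalk u p v \<and> set p \<subseteq> W \<times> W"
    using assms(1)
  proof (induction rule: converse_rtrancl_induct)
    case base
    have "v \<in> W" using assms(1,2) by (induction rule: rtrancl_induct) auto
    then show ?case using assms(3) by (intro exI[of _ "[]"]) (auto simp: awalk_Nil_iff)
  next
    case (step y z)
    then obtain p where "awalk z p v" "set p \<subseteq> W \<times> W" by blast
    with step show ?case by (intro exI[of _ "(y, z) # p"]) (auto simp: awalk_Cons_iff)
  qed
  then obtain p where p: "awalk u p v" "set p \<subseteq> W \<times> W" by blast
  let ?q = "awalk_to_apath p"
  have q: "apath u ?q v" using p(1) by (rule apath_awalk_to_apath)
  have "set ?q \<subseteq> W \<times> W" using awalk_to_apath_subset[OF p(1)] p(2) by blast
  then have "set (pawalk_verts u ?q) \<subseteq> W"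
    using set_awalk_verts[OF awalkI_apath[OF q]] assms(2) by auto
  with q that show thesis by (auto simp: apath_def)
qed

text \<open>The tail of \<open>e\<close> is already the last vertex of \<open>p\<close>, so the
  lists concatenate without repeating it. This splits the vertices of the closed walk below into
  those in \<open>X\<close> and those in \<open>W\<close>.\<close>

lemma pawalk_verts_append_Cons:
  "pcas x p (fst e) \<Longrightarrow> pawalk_verts x (p @ e # q) = pawalk_verts x p @ pawalk_verts (snd e) q"
  by (induction p arbitrary: x) auto

text \<open>Two edges between \<open>W\<close> and \<open>X\<close>, closed up by a path inside each
  set, form a cycle. In a tree it has length below 3, so both paths are empty and the edges
  coincide.\<close>

lemma undirected_tree_edge_between_unique:
  assumes T: "undirected_tree T"
    and W: "connected_on (parcs T) W" "W \<subseteq> pverts T"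
    and X: "connected_on (parcs T) X" "X \<subseteq> pverts T"
    and disj: "W \<inter> X = {}"
    and e: "(w, x) \<in> parcs T" "w \<in> W" "x \<in> X"
    and e': "(w', x') \<in> parcs T" "w' \<in> W" "x' \<in> X"
  shows "w' = w \<and> x' = x"
proof -
  interpret pair_graph T using T by (simp add: undirected_tree_def)
  obtain p where p: "awalk x p x'" "distinct (pawalk_verts x p)" "set (pawalk_verts x p) \<subseteq> X"
    using apath_within[of x x' X] X e e' unfolding connected_on_def by blast
  obtain q where q: "awalk w' q w" "distinct (pawalk_verts w' q)" "set (pawalk_verts w' q) \<subseteq> W"
    using apath_within[of w' w W] W e e' unfolding connected_on_def by blast
  \<comment> \<open>From \<open>w\<close> over to \<open>x\<close>, through \<open>X\<close> to
    \<open>x'\<close>, back over to \<open>w'\<close>, and through \<open>W\<close> to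
    \<open>w\<close>.\<close>
  let ?c = "(w, x) # p @ (x', w') # q"
  have "(x', w') \<in> parcs T" using e'(1) pair_graphD(1) pair_graph_axioms by (meson symD)
  then have "awalk x' ((x', w') # q) w" using q by (simp add: awalk_Cons_iff)
  with p(1) have "awalk x (p @ (x', w') # q) w" by (rule awalk_appendI)
  then have "awalk w ?c w" using e(1) unfolding awalk_Cons_iff by simp
  moreover have "pcas x p (fst (x', w'))" using p(1) by (auto simp: awalk_def)
  then have "distinct (tl (pawalk_verts w ?c))"
    using p q disj pawalk_verts_append_Cons[of x p "(x', w')" q] by auto
  ultimately have "cycle ?c" unfolding cycle_def by blast
  \<comment> \<open>The length is 2 plus those of \<open>p\<close> and \<open>q\<close>. Length 2,
    the walk along one edge and back, is also a \<open>cycle\<close> and is not excluded.\<close>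
  then have "length ?c < 3" using T unfolding undirected_tree_def by (metis not_le_imp_less)
  then have "p = []" "q = []" by (auto simp: Suc_le_eq numeral_3_eq_3)
  then show ?thesis using p(1) q(1) by (auto simp: awalk_Nil_iff)
qed

subsection \<open>Matched trees belong to the family\<close>

definition pair_induce :: "'a pair_pre_digraph \<Rightarrow> 'a set \<Rightarrow> 'a pair_pre_digraph" where
  "pair_induce G W = \<lparr>pverts = W, parcs = Restr (parcs G) W\<rparr>"

text \<open>By uniqueness of the connecting edge, the only arcs of the union not inside one of the
  two sets are \<open>(w, x)\<close> and its reverse.\<close>

lemma pair_induce_join:
  assumes T: "undirected_tree T"
    and W: "connected_on (parcs T) W" "W \<subseteq> pverts T"
    and X: "connected_on (parcs T) X" "X \<subseteq> pverts T"
    and disj: "W \<inter> X = {}"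
    and e: "(w, x) \<in> parcs T" "w \<in> W" "x \<in> X"
  shows "pair_induce T (W \<union> X) = join_by_edge (pair_induce T W) (pair_induce T X) w x"
proof -
  have sym: "sym (parcs T)" using T pair_graphD(1) by (auto simp: undirected_tree_def)
  note uniq = undirected_tree_edge_between_unique[OF T W X disj e]
  have "(u, v) \<in> Restr (parcs T) (W \<union> X) \<longleftrightarrow>
      (u, v) \<in> Restr (parcs T) W \<union> Restr (parcs T) X \<union> {(w, x), (x, w)}" for u v
    using uniq[of u v] uniq[of v u] e sym by (auto dest: symD)
  then have "Restr (parcs T) (W \<union> X) =
      Restr (parcs T) W \<union> Restr (parcs T) X \<union> {(w, x), (x, w)}"
    by (intro set_eqI) (metis surj_pair)
  then show ?thesis by (simp add: pair_induce_def join_by_edge_def)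
qed

lemma pair_induce_edge:
  assumes "pair_graph G" "(x, y) \<in> parcs G"
  shows "pair_induce G {x, y} = path_graph [x, y]"
proof -
  interpret pair_graph G by fact
  have "(y, x) \<in> parcs G" using assms pair_graphD(1) by (meson symD)
  then show ?thesis
    using assms(2) pair_no_loops by (fastforce simp: pair_induce_def path_graph_2)
qed

text \<open>The path has no chords, because it is the join of the connected sets
  \<open>{a, b}\<close> and \<open>{c, d}\<close> by the edge from \<open>b\<close> to
  \<open>c\<close>.\<close>

lemma pair_induce_path_4:
  assumes T: "undirected_tree T" and d: "distinct [a, b, c, d]"
    and e: "(a, b) \<in> parcs T" "(b, c) \<in> parcs T" "(c, d) \<in> parcs T"
  shows "pair_induce T {a, b, c, d} = path_graph [a, b, c, d]"
    and "connected_on (parcs T) {a, b, c, d}"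
proof -
  have G: "pair_graph T" using T by (simp add: undirected_tree_def)
  note GD = pair_graphD[OF G]
  have eq: "{a, b} \<union> {c, d} = {a, b, c, d}" by auto
  have con: "connected_on (parcs T) {a, b}" "connected_on (parcs T) {c, d}"
    using e GD by (auto intro: connected_on_edge)
  have "pair_induce T ({a, b} \<union> {c, d}) = join_by_edge (path_graph [a, b]) (path_graph [c, d]) b c"
    using pair_induce_join[OF T con(1) _ con(2), of b c] d e GD(2)
      pair_induce_edge[OF G e(1)] pair_induce_edge[OF G e(3)] by auto
  then show "pair_induce T {a, b, c, d} = path_graph [a, b, c, d]"
    unfolding eq by (auto simp: join_by_edge_def path_graph_2 path_graph_4)
  show "connected_on (parcs T) {a, b, c, d}"
    using connected_on_Un[OF con, of b c] e GD(1) unfolding eq by simp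
qed

text \<open>Closure under neighbours of the other colour forces every edge leaving \<open>W\<close>
  to join equal colours, as both operations require.\<close>

definition family_part :: "'a pair_pre_digraph \<Rightarrow> ('a \<Rightarrow> color) \<Rightarrow> 'a set \<Rightarrow> bool" where
  "family_part T f W \<longleftrightarrow>
     W \<noteq> {} \<and> W \<subseteq> pverts T \<and> connected_on (parcs T) W \<and>
     (\<forall>v u. v \<in> W \<longrightarrow> (v, u) \<in> parcs T \<longrightarrow> f u \<noteq> f v \<longrightarrow> u \<in> W) \<and>
     (pair_induce T W, f) \<in> colored_family"

locale matched_tree =
  fixes T :: "'a pair_pre_digraph" and f :: "'a \<Rightarrow> color"
  assumes T: "undirected_tree T" and f: "matched_coloring T f"
begin

lemma G: "pair_graph T"
  using T by (simp add: undirected_tree_def)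

lemmas sym = pair_graphD(1)[OF G] and wf = pair_graphD(2)[OF G]

lemma opposite_neighbour:
  assumes "v \<in> pverts T"
  obtains u where "(v, u) \<in> parcs T" "f u \<noteq> f v"
  using f assms unfolding matched_coloring_def by blast

lemma opposite_neighbour_unique:
  assumes "(v, u) \<in> parcs T" "f u \<noteq> f v" "(v, u') \<in> parcs T" "f u' \<noteq> f v"
  shows "u' = u"
proof -
  have "\<exists>!u. (v, u) \<in> parcs T \<and> f u \<noteq> f v"
    using f assms(1) wf by (auto simp: matched_coloring_def)
  with assms show ?thesis by metis
qed

lemma amber_neighbour:
  assumes "v \<in> pverts T" "f v = Amber"
  obtains u where "(v, u) \<in> parcs T" "f u = Amber"
  using f assms unfolding matched_coloring_def by blast

lemma symD': "(u, v) \<in> parcs T \<Longrightarrow> (v, u) \<in> parcs T"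
  using sym by (meson symD)

text \<open>Take for \<open>d\<close> the blue neighbour of \<open>c\<close>. It differs from
  \<open>a\<close>, since otherwise the blue vertex \<open>a\<close> would have the two amber
  neighbours \<open>b\<close> and \<open>c\<close>.\<close>

lemma amber_edge_path:
  assumes bc: "(b, c) \<in> parcs T" "f b = Amber" "f c = Amber" and ab: "(a, b) \<in> parcs T" "f a = Blue"
  obtains d where "distinct [a, b, c, d]" "(c, d) \<in> parcs T" "f d = Blue"
proof -
  obtain d where d: "(c, d) \<in> parcs T" "f d \<noteq> f c"
    using opposite_neighbour bc wf by blast
  then have "f d = Blue" using bc by (cases "f d") auto
  have "b \<noteq> c" using bc(1) G pair_loopfree_digraph.pair_no_loops
    by (fastforce simp: pair_graph_def pair_digraph_def)
  moreover have "a \<noteq> d"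
    using opposite_neighbour_unique[of a b c] symD'[OF d(1)] ab bc \<open>b \<noteq> c\<close> by auto
  ultimately have "distinct [a, b, c, d]" using \<open>f d = Blue\<close> ab bc by auto
  then show thesis using d(1) \<open>f d = Blue\<close> by (rule that)
qed

text \<open>The end edges already match all four vertices within the path, and a neighbour of the
  other colour is unique.\<close>

lemma closed_path_4:
  assumes "(a, b) \<in> parcs T" "(c, d) \<in> parcs T"
    and "f a = Blue" "f b = Amber" "f c = Amber" "f d = Blue"
    and "v \<in> {a, b, c, d}" "(v, u) \<in> parcs T" "f u \<noteq> f v"
  shows "u \<in> {a, b, c, d}"
proof -
  have "\<exists>u' \<in> {a, b, c, d}. (v, u') \<in> parcs T \<and> f u' \<noteq> f v"
    using assms(1-7) symD' by auto
  then show ?thesis using assms(8,9) opposite_neighbour_unique by blast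
qed

text \<open>An amber vertex, an amber neighbour of it and the blue neighbours of both form a
  coloured \<open>P_4\<close>, the base of the family.\<close>

lemma family_part_exists:
  assumes "pverts T \<noteq> {}"
  shows "\<exists>W. family_part T f W"
proof -
  obtain v where v: "v \<in> pverts T" using assms by blast
  obtain b where b: "b \<in> pverts T" "f b = Amber"
  proof (cases "f v")
    case Blue
    obtain u where u: "(v, u) \<in> parcs T" "f u \<noteq> f v" using opposite_neighbour[OF v] by blast
    then have "u \<in> pverts T" "f u = Amber" using wf Blue by auto
    then show thesis by (rule that)
  qed (use v that in blast)
  obtain c where c: "(b, c) \<in> parcs T" "f c = Amber" using amber_neighbour b by blast
  obtain a where a: "(b, a) \<in> parcs T" "f a \<noteq> f b" using opposite_neighbour b by blast
  then have fa: "f a = Blue" using b by (cases "f a") auto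
  note ab = symD'[OF a(1)]
  obtain d where d: "distinct [a, b, c, d]" "(c, d) \<in> parcs T" "f d = Blue"
    using amber_edge_path[OF c(1) b(2) c(2) ab fa] by blast
  note path = pair_induce_path_4[OF T d(1) ab c(1) d(2)]
  have "family_part T f {a, b, c, d}"
    unfolding family_part_def path(1)
  proof (intro conjI allI impI)
    show "{a, b, c, d} \<subseteq> pverts T" using ab c(1) d(2) wf by auto
    show "connected_on (parcs T) {a, b, c, d}" by (fact path(2))
    show "u \<in> {a, b, c, d}" if "v \<in> {a, b, c, d}" "(v, u) \<in> parcs T" "f u \<noteq> f v" for v u
      using closed_path_4[OF ab d(2) fa b(2) c(2) d(3) that] .
    show "(path_graph [a, b, c, d], f) \<in> colored_family"
      using d(1) fa b(2) c(2) d(3) by (rule colored_family.base)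
  qed simp
  then show ?thesis by blast
qed

text \<open>The part of the growth step common to both operations; only membership in the family,
  \<open>fam\<close>, is left to each of them.\<close>

lemma family_part_extend:
  assumes W: "family_part T f W" and X: "X \<subseteq> pverts T" "connected_on (parcs T) X" "W \<inter> X = {}"
    and closed: "\<And>v u. v \<in> X \<Longrightarrow> (v, u) \<in> parcs T \<Longrightarrow> f u \<noteq> f v \<Longrightarrow> u \<in> X"
    and e: "(w, x) \<in> parcs T" "w \<in> W" "x \<in> X"
    and fam: "(join_by_edge (pair_induce T W) (pair_induce T X) w x, f) \<in> colored_family"
  shows "family_part T f (W \<union> X)"
proof -
  note Wd = W[unfolded family_part_def]
  have "(pair_induce T (W \<union> X), f) \<in> colored_family"
    using pair_induce_join[OF T _ _ X(2,1,3) e] Wd fam by simp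
  moreover have "connected_on (parcs T) (W \<union> X)"
    using connected_on_Un[OF _ X(2) e(2,3,1) sym] Wd by simp
  ultimately show ?thesis using Wd X closed unfolding family_part_def by blast
qed

lemma family_part_grows:
  assumes W: "family_part T f W" and neq: "W \<noteq> pverts T"
  shows "\<exists>W'. family_part T f W' \<and> W \<subset> W'"
proof -
  note Wd = W[unfolded family_part_def]
  obtain u v where "u \<in> W" "v \<in> pverts T - W" using Wd neq by blast
  then obtain w x where e: "(w, x) \<in> parcs T" "w \<in> W" "x \<notin> W"
    using rtrancl_leaves_set[of u v "parcs T" W] undirected_tree_connected[OF T, of u v] Wd by blast
  \<comment> \<open>If the colours differed, closure of \<open>W\<close> would put \<open>x\<close>
    into \<open>W\<close>.\<close>
  have fwx: "f x = f w" using Wd e by metis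
  have out: "v \<notin> W" if "u \<notin> W" "(u, v) \<in> parcs T" "f v \<noteq> f u" for u v
    using Wd that symD' by metis
  obtain y where y: "(x, y) \<in> parcs T" "f y \<noteq> f x" using opposite_neighbour e wf by blast
  have xV: "x \<in> pverts T" and yV: "y \<in> pverts T" using y wf by auto
  have yW: "y \<notin> W" using out e y by blast
  have conn_xy: "connected_on (parcs T) {x, y}" using y sym by (intro connected_on_edge)
  have "\<exists>X. X \<noteq> {} \<and> W \<inter> X = {} \<and> family_part T f (W \<union> X)"
  proof (cases "f w")
    case Amber
    then have fxy: "f x = Amber" "f y = Blue" using fwx y by (cases "f y"; simp)+
    have closed: "u \<in> {x, y}" if v: "v \<in> {x, y}" and u: "(v, u) \<in> parcs T" "f u \<noteq> f v" for v u
    proof -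
      have "\<exists>u' \<in> {x, y}. (v, u') \<in> parcs T \<and> f u' \<noteq> f v" using v y symD' by auto
      then show ?thesis using u opposite_neighbour_unique by blast
    qed
    have ne: "distinct [x, y]" using y by auto
    have "(join_by_edge (pair_induce T W) (path_graph [x, y]) w x, f(x := Amber, y := Blue))
        \<in> colored_family"
      using Wd e yW Amber ne by (intro colored_family.op1) (auto simp: pair_induce_def)
    then have "(join_by_edge (pair_induce T W) (pair_induce T {x, y}) w x, f) \<in> colored_family"
      using pair_induce_edge[OF G y(1)] fxy by (simp add: fun_upd_idem)
    moreover have sub: "{x, y} \<subseteq> pverts T" and disj: "W \<inter> {x, y} = {}"
      using xV yV e(3) yW by auto
    ultimately have "family_part T f (W \<union> {x, y})"
      using family_part_extend[OF W sub conn_xy disj closed e(1,2)] by simp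
    with disj show ?thesis by (intro exI[of _ "{x, y}"]) simp
  next
    case Blue
    then have fxy: "f x = Blue" "f y = Amber" using fwx y by (cases "f y"; simp)+
    obtain c where c: "(y, c) \<in> parcs T" "f c = Amber"
      using amber_neighbour[OF _ fxy(2)] yV by blast
    obtain d where d: "distinct [x, y, c, d]" "(c, d) \<in> parcs T" "f d = Blue"
      using amber_edge_path[OF c(1) fxy(2) c(2) y(1) fxy(1)] by blast
    note path = pair_induce_path_4[OF T d(1) y(1) c(1) d(2)]
    \<comment> \<open>Otherwise the edge from \<open>c\<close> to \<open>y\<close> would be a second
      edge between \<open>W\<close> and the connected set \<open>{x, y}\<close>.\<close>
    have "c \<notin> W"
    proof
      assume "c \<in> W"
      then have "c = w \<and> y = x"
        using undirected_tree_edge_between_unique[OF T _ _ conn_xy _ _ e(1,2) _ symD'[OF c(1)]]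
          Wd e(3) yW xV yV by simp
      then show False using d(1) by simp
    qed
    then have dW: "d \<notin> W" using out d c by simp
    have fam: "(join_by_edge (pair_induce T W) (path_graph [x, y, c, d]) w x,
        f(x := Blue, y := Amber, c := Amber, d := Blue)) \<in> colored_family"
      using Wd e yW \<open>c \<notin> W\<close> dW Blue d(1)
      by (intro colored_family.op2) (auto simp: pair_induce_def)
    have upd: "f(x := Blue, y := Amber, c := Amber, d := Blue) = f"
      using fxy c d by auto
    have sub: "{x, y, c, d} \<subseteq> pverts T" and disj: "W \<inter> {x, y, c, d} = {}"
      using xV yV d(2) wf e(3) yW dW \<open>c \<notin> W\<close> by auto
    have "family_part T f (W \<union> {x, y, c, d})"
      using family_part_extend[OF W sub path(2) disj closed_path_4[OF y(1) d(2) fxy c(2) d(3)] e(1,2)]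
        fam[unfolded upd] path(1) by simp
    with disj show ?thesis by (intro exI[of _ "{x, y, c, d}"]) simp
  qed
  then obtain X where "X \<noteq> {}" "W \<inter> X = {}" "family_part T f (W \<union> X)" by metis
  moreover from this have "W \<subset> W \<union> X" by blast
  ultimately show ?thesis by metis
qed

text \<open>As the vertex set is finite, there is an inclusion-maximal family part; since every
  proper one grows, it contains all vertices.\<close>

lemma in_colored_family:
  assumes "pverts T \<noteq> {}"
  shows "(T, f) \<in> colored_family"
proof -
  let ?P = "{W. family_part T f W}"
  have "?P \<subseteq> Pow (pverts T)" by (auto simp: family_part_def)
  then have "finite ?P" using pair_graphD(3)[OF G] finite_subset by blast
  then obtain W where "family_part T f W" "\<forall>W'. family_part T f W' \<longrightarrow> W \<subseteq> W' \<longrightarrow> W = W'"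
    using finite_has_maximal[of ?P] family_part_exists[OF assms] by blast
  with family_part_grows[of W] have "family_part T f (pverts T)" by blast
  moreover have "pair_induce T (pverts T) = T" using wf by (auto simp: pair_induce_def Int_absorb2)
  ultimately show ?thesis by (simp add: family_part_def)
qed

end

theorem theorem4p3:
  fixes T :: "'a pair_pre_digraph"
  assumes "undirected_tree T"
    and "card (pverts T) \<ge> 2"
  shows "real (esp_number T) = 1 / 2 * real (card (pverts T)) \<longleftrightarrow>
         (\<exists>f :: 'a \<Rightarrow> color. (T, f) \<in> colored_family)"
proof -
  have "real (esp_number T) = 1 / 2 * real (card (pverts T)) \<longleftrightarrow> 2 * esp_number T = card (pverts T)"
    by linarith
  also have "\<dots> \<longleftrightarrow> (\<exists>f. matched_coloring T f)"
    using assms(1) by (intro esp_number_eq_half_iff) (simp add: undirected_tree_def)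
  also have "\<dots> \<longleftrightarrow> (\<exists>f. (T, f) \<in> colored_family)"
  proof -
    \<comment> \<open>Nonemptiness provides the vertex from which the initial \<open>P_4\<close> is
      built.\<close>
    have "pverts T \<noteq> {}" using assms(2) by auto
    then show ?thesis
      using assms(1) matched_tree.in_colored_family[OF matched_tree.intro]
        matched_coloring_colored_family by blast
  qed
  finally show ?thesis .
qed

end
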